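(* For every positive integer $N$, $$S_{3,0}(N)=3\,S_{3,0}\left(\left\lfloor \tfrac N4\right\rfloor\right)+\nu(N),$$ where $$\nu(N)=\begin{cases} 0, & \text{if } N\equiv 0,7,8,9,16,17,18,22,23 \pmod{24},\\ (-1)^{s(N)}, & \text{if } N\equiv 3,4,10,12,20 \pmod{24},\\ (-1)^{s(N)+1}, & \text{if } N\equiv 1,2,5,6,11,19,21 \pmod{24},\\ 2(-1)^{s(N)}, & \text{if } N\equiv 15 \pmod{24},\\ 2(-1)^{s(N)+1}, & \text{if } N\equiv 13,14 \pmod{24}.\end{cases}$$
   Context: For a nonnegative integer $n$, $s(n)$ denotes the sum of the binary digits of $n$. For a nonnegative integer $x$, $$S_{3,0}(x)=\sum_{0\leq n<x,\ n\equiv 0 \pmod 3}(-1)^{s(n)};$$ in particular $S_{3,0}(0)=0$. *)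

theory Defs
  imports Main
begin

fun s :: "nat \<Rightarrow> nat" where
  "s n = (if n = 0 then 0 else n mod 2 + s (n div 2))"

declare s.simps [simp del]

definition S30 :: "nat \<Rightarrow> int" where
  "S30 x = (\<Sum>n | n < x \<and> n mod 3 = 0. (-1) ^ s n)"

definition nu :: "nat \<Rightarrow> int" where
  "nu N =
    (if N mod 24 \<in> {0, 7, 8, 9, 16, 17, 18, 22, 23} then 0
     else if N mod 24 \<in> {3, 4, 10, 12, 20} then (-1) ^ s N
     else if N mod 24 \<in> {1, 2, 5, 6, 11, 19, 21} then (-1) ^ (s N + 1)
     else if N mod 24 = 15 then 2 * (-1) ^ s N
     else \<comment> \<open>the remaining residues are 13 and 14\<close>
       2 * (-1) ^ (s N + 1))"

end

(* Since 4m + r \<equiv> m + r (mod 3) and (-1)^s(4m + r) = \<plusminus>(-1)^s(m) with signs +, -, -, + for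
   r = 0, 1, 2, 3, the block {4m,...,4m+3} contributes 2, -1 or -1 times (-1)^s(m) to S30,
   according to m mod 3. This is 3 [3 | m] - 1 times (-1)^s(m), so summing over m < x gives
   S30 (4x) = 3 * S30 x - (\<Sum>m<x. (-1)^s(m)). The terms of the last sum cancel in pairs
   {2k, 2k + 1}, which leaves - (-1)^s(x) if x is odd and 0 otherwise. The fewer than four terms
   between 4x and N are (-1)^s(x) times a sign determined by their residue mod 12. *)
theory Submission
  imports Defs
begin

lemma s_double: "s (2 * n) = s n"
  by (cases "n = 0") (simp_all add: s.simps [of "2 * n"])

lemma s_Suc_double: "s (Suc (2 * n)) = Suc (s n)"
  by (simp add: s.simps [of "Suc (2 * n)"])

lemma s_quadruple:
  "s (4 * n) = s n"
  "s (4 * n + 1) = Suc (s n)"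
  "s (4 * n + 2) = Suc (s n)"
  "s (4 * n + 3) = Suc (Suc (s n))"
proof -
  have "4 * n = 2 * (2 * n)" "4 * n + 1 = Suc (2 * (2 * n))" "4 * n + 2 = 2 * Suc (2 * n)"
    "4 * n + 3 = Suc (2 * Suc (2 * n))"
    by simp_all
  then show "s (4 * n) = s n" "s (4 * n + 1) = Suc (s n)" "s (4 * n + 2) = Suc (s n)"
    "s (4 * n + 3) = Suc (Suc (s n))"
    by (simp_all only: s_double s_Suc_double)
qed

lemma S30_0: "S30 0 = 0"
  by (simp add: S30_def)

lemma S30_Suc: "S30 (Suc x) = S30 x + (if x mod 3 = 0 then (-1) ^ s x else 0)"
proof -
  have "{n. n < Suc x \<and> n mod 3 = 0} =
      (if x mod 3 = 0 then insert x {n. n < x \<and> n mod 3 = 0} else {n. n < x \<and> n mod 3 = 0})"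
    by (auto simp: less_Suc_eq)
  then show ?thesis
    by (simp add: S30_def)
qed

text \<open>Each increment is expressed through \<open>x\<close> alone. All four together make up a
  full block for the induction on \<open>x\<close>; the first three reach the incomplete block below
  \<open>N\<close>.\<close>

lemma S30_quadruple_add:
  "S30 (4 * x + 1) = S30 (4 * x) + (if x mod 3 = 0 then (-1) ^ s x else 0)"
  "S30 (4 * x + 2) = S30 (4 * x + 1) - (if x mod 3 = 2 then (-1) ^ s x else 0)"
  "S30 (4 * x + 3) = S30 (4 * x + 2) - (if x mod 3 = 1 then (-1) ^ s x else 0)"
  "S30 (4 * x + 4) = S30 (4 * x + 3) + (if x mod 3 = 0 then (-1) ^ s x else 0)"
proof -
  have mods: "(4 * x) mod 3 = 0 \<longleftrightarrow> x mod 3 = 0" "(4 * x + 1) mod 3 = 0 \<longleftrightarrow> x mod 3 = 2"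
    "(4 * x + 2) mod 3 = 0 \<longleftrightarrow> x mod 3 = 1" "(4 * x + 3) mod 3 = 0 \<longleftrightarrow> x mod 3 = 0"
    by presburger+
  have sucs: "Suc (4 * x) = 4 * x + 1" "Suc (4 * x + 1) = 4 * x + 2"
    "Suc (4 * x + 2) = 4 * x + 3" "Suc (4 * x + 3) = 4 * x + 4"
    by simp_all
  note steps = S30_Suc [of "4 * x", unfolded sucs s_quadruple mods]
    S30_Suc [of "4 * x + 1", unfolded sucs s_quadruple mods]
    S30_Suc [of "4 * x + 2", unfolded sucs s_quadruple mods]
    S30_Suc [of "4 * x + 3", unfolded sucs s_quadruple mods]
  show "S30 (4 * x + 1) = S30 (4 * x) + (if x mod 3 = 0 then (-1) ^ s x else 0)"
    by (rule steps(1))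
  show "S30 (4 * x + 2) = S30 (4 * x + 1) - (if x mod 3 = 2 then (-1) ^ s x else 0)"
    unfolding steps(2) by simp
  show "S30 (4 * x + 3) = S30 (4 * x + 2) - (if x mod 3 = 1 then (-1) ^ s x else 0)"
    unfolding steps(3) by simp
  show "S30 (4 * x + 4) = S30 (4 * x + 3) + (if x mod 3 = 0 then (-1) ^ s x else 0)"
    unfolding steps(4) by simp
qed

text \<open>The last term is the closed form of minus the sum of \<open>(-1) ^ s m\<close> over
  \<open>m < x\<close>, so the induction never mentions that sum.\<close>

lemma S30_quadruple: "S30 (4 * x) = 3 * S30 x + (if odd x then (-1) ^ s x else 0)"
proof (induction x)
  case 0
  show ?case by (simp add: S30_0)
next
  case (Suc x)
  \<comment> \<open>Each block must lower the correction term by \<open>(-1) ^ s x\<close>. For odd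
    \<open>x\<close> it drops to 0 at once; for even \<open>x\<close> it starts at 0, and the last
    digit turning from 0 to 1 flips the sign.\<close>
  have "(-1 :: int) ^ s (Suc x) = - ((-1) ^ s x)" if "even x"
    using that by (auto elim!: evenE simp: s_double s_Suc_double)
  moreover have "S30 (4 * Suc x) = S30 (4 * x + 4)"
    by (simp add: add.commute)
  moreover have "x mod 3 = 0 \<or> x mod 3 = 1 \<or> x mod 3 = 2"
    by presburger
  ultimately show ?case
    using Suc.IH S30_quadruple_add [of x] by (auto simp: S30_Suc split: if_splits)
qed

theorem mainTheorem5:
  fixes N :: nat
  assumes "N > 0"
  shows "S30 N = 3 * S30 (N div 4) + nu N"
proof -
  define x r where "x = N div 4" and "r = N mod 4"
  have N: "N = 4 * x + r" and "r < 4"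
    by (simp_all add: x_def r_def)
  then have r: "r = 0 \<or> r = 1 \<or> r = 2 \<or> r = 3"
    by auto
  \<comment> \<open>The correction term depends on the parity of \<open>x\<close>, the increments on
    \<open>x mod 3\<close>; \<open>q\<close> records both, and with \<open>r\<close> it determines
    \<open>N mod 24\<close>.\<close>
  define q where "q = x mod 6"
  have "q < 6"
    by (simp add: q_def)
  then have q: "q = 0 \<or> q = 1 \<or> q = 2 \<or> q = 3 \<or> q = 4 \<or> q = 5"
    by auto
  have "x = q + 6 * (x div 6)"
    by (simp add: q_def)
  then have "N = (4 * q + r) + 24 * (x div 6)"
    using N by linarith
  then have "N mod 24 = (4 * q + r) mod 24"
    by (metis mod_mult_self2)
  then have N_mod: "N mod 24 = 4 * q + r"
    using \<open>q < 6\<close> \<open>r < 4\<close> by simp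
  have x_mod: "odd x \<longleftrightarrow> odd q" "x mod 3 = q mod 3"
    by (simp_all add: q_def mod_mod_cancel dvd_mod_iff)
  \<comment> \<open>In each of the 24 cases, \<open>s_quadruple\<close> turns the sign of
    \<open>N\<close> in \<open>nu\<close> into that of \<open>x\<close>.\<close>
  have "nu N = S30 N - 3 * S30 x"
    using r q N_mod x_mod N S30_quadruple [of x] s_quadruple [of x] S30_quadruple_add [of x]
    by (elim disjE) (simp_all add: nu_def)
  then show ?thesis
    by (simp add: x_def)
qed

end
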